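(* Let $n\ge1$ and let $A\subset\mathbb{M}_n$ be a unital subalgebra. Put $B=C^*(A)$. Assume that either (a) $n\le2$, or (b) $n=3$ and the only normal matrices in $A$ are scalar multiples of the identity. Then $$\sup\{\omega(a^*a):\omega\text{ is a }\mathcal{Q}(A)\text{-peak state on }B\}=\|a\|^2$$ for every $a\in A$.
   Context: $\mathbb{M}_n$ is the $C^*$-algebra of complex $n\times n$ matrices; a unital subalgebra contains the identity $I$ and need not be self-adjoint; $C^*(A)$ is the $C^*$-subalgebra of $\mathbb{M}_n$ generated by $A$. $\mathcal{Q}(A)=\{a^*a:a\in A\}$. A state $\omega$ on $B$ is a $\mathcal{Q}(A)$-peak state if there is $y\in\mathcal{Q}(A)$ such that $\omega(y)=1$ and $|\psi(y)|<1$ for every state $\psi$ on $B$ distinct from $\omega$. *)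

theory Defs
  imports "HOL-Analysis.Analysis"
begin

definition star :: "complex^'n^'m \<Rightarrow> complex^'m^'n"
  where "star a = map_matrix cnj (transpose a)"

definition mscale :: "complex \<Rightarrow> complex^'n^'m \<Rightarrow> complex^'n^'m"
  where "mscale c a = map_matrix ((*) c) a"

(* The library norm of the type complex^'n^'n is the Frobenius norm; the C*-norm is the operator
   norm with respect to the Euclidean norm of complex^'n. *)
definition op_norm :: "complex^'n^'m \<Rightarrow> real"
  where "op_norm a = onorm ((*v) a)"

definition normal_mat :: "complex^'n^'n \<Rightarrow> bool"
  where "normal_mat a \<longleftrightarrow> star a ** a = a ** star a"

definition subalgebra :: "(complex^'n^'n) set \<Rightarrow> bool"
  where "subalgebra A \<longleftrightarrow>
    0 \<in> A \<and>
    (\<forall>a\<in>A. \<forall>b\<in>A. a + b \<in> A) \<and>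
    (\<forall>c. \<forall>a\<in>A. mscale c a \<in> A) \<and>
    (\<forall>a\<in>A. \<forall>b\<in>A. a ** b \<in> A)"

definition unital_subalgebra :: "(complex^'n^'n) set \<Rightarrow> bool"
  where "unital_subalgebra A \<longleftrightarrow> subalgebra A \<and> mat 1 \<in> A"

(* All norms on complex^'n^'n induce the same topology, so "closed" is closedness in the C*-norm. *)
definition cstar_subalgebra :: "(complex^'n^'n) set \<Rightarrow> bool"
  where "cstar_subalgebra B \<longleftrightarrow> subalgebra B \<and> (\<forall>b\<in>B. star b \<in> B) \<and> closed B"

definition cstar_generated :: "(complex^'n^'n) set \<Rightarrow> (complex^'n^'n) set"
  where "cstar_generated A = \<Inter>{B. cstar_subalgebra B \<and> A \<subseteq> B}"

definition Q_set :: "(complex^'n^'n) set \<Rightarrow> (complex^'n^'n) set"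
  where "Q_set A = (\<lambda>a. star a ** a) ` A"

(* States on a C*-subalgebra B containing the identity matrix: the unital positive linear
   functionals. They are functions on B only, represented by functions that are undefined outside
   B, so that equality of states is equality on B. *)
definition states :: "(complex^'n^'n) set \<Rightarrow> (complex^'n^'n \<Rightarrow> complex) set"
  where "states B = {\<omega>. \<omega> \<in> extensional B \<and>
    (\<forall>a\<in>B. \<forall>b\<in>B. \<omega> (a + b) = \<omega> a + \<omega> b) \<and>
    (\<forall>c. \<forall>a\<in>B. \<omega> (mscale c a) = c * \<omega> a) \<and>
    (\<forall>b\<in>B. \<omega> (star b ** b) \<in> \<real>\<^sub>\<ge>\<^sub>0) \<and>
    \<omega> (mat 1) = 1}"

definition Q_peak_states :: "(complex^'n^'n) set \<Rightarrow> (complex^'n^'n) set \<Rightarrow> (complex^'n^'n \<Rightarrow> complex) set"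
  where "Q_peak_states A B = {\<omega> \<in> states B.
    \<exists>y\<in>Q_set A. \<omega> y = 1 \<and> (\<forall>\<psi>\<in>states B. \<psi> \<noteq> \<omega> \<longrightarrow> cmod (\<psi> y) < 1)}"

end

theory Submission imports Defs begin

text \<open>Call a vector norming for \<open>b\<close> if \<open>b\<close> attains its operator norm there. The norming vectors of \<open>b\<close> are
the eigenvectors of \<open>b\<^sup>*b\<close> for its largest eigenvalue \<open>\<parallel>b\<parallel>\<^sup>2\<close> (together with \<open>0\<close>), so they form a
complex subspace. Two facts give the theorem.

First, suppose that a nonzero \<open>b \<in> A\<close> has a one-dimensional space of norming vectors, spanned by a unit vector
\<open>\<xi>\<close>. Then the vector state of \<open>\<xi>\<close> is a peak state (\<open>simple_norming_peaks\<close>): with \<open>y = b\<^sup>*b / \<parallel>b\<parallel>\<^sup>2\<close>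
the powers \<open>y^(2^k)\<close> converge to the projection \<open>e\<close> onto \<open>\<xi>\<close>, which therefore lies in \<open>B\<close>; a
state \<open>\<psi>\<close> with \<open>\<psi>(y) = 1\<close> takes a value at least \<open>1\<close> at each of these powers, so \<open>\<psi>(e) = 1\<close>, and
then \<open>\<psi>(x) = \<psi>(e x e)\<close> is determined because \<open>e x e\<close> is \<open>\<langle>\<xi>, x \<xi>\<rangle> e\<close>.

Second, if \<open>A\<close> contains more than the scalars, then the elements with a one-dimensional space of
norming vectors are dense in \<open>A\<close> (\<open>simple_norming_approximation\<close>). It is enough to perturb a
non-scalar \<open>a\<close> by small scalars \<open>z\<close>. Suppose that \<open>a\<close> and all \<open>a + z\<close> have at least two orthogonal
norming vectors. In dimension 2 every vector is then norming for all of them. In dimension 3 the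
parallelogram law
\<open>\<parallel>(a + z) x\<parallel>\<^sup>2 + \<parallel>(a - z) x\<parallel>\<^sup>2 = 2 \<parallel>a x\<parallel>\<^sup>2 + 2 \<bar>z\<bar>\<^sup>2 \<parallel>x\<parallel>\<^sup>2\<close>
and the fact that any two two-dimensional subspaces meet give
\<open>\<parallel>a + z\<parallel>\<^sup>2 + \<parallel>a - z\<parallel>\<^sup>2 = 2 \<parallel>a\<parallel>\<^sup>2 + 2 \<bar>z\<bar>\<^sup>2\<close>, so that the norming vectors of \<open>a\<close> are norming for
\<open>a + z\<close> too. A vector that is norming for \<open>a\<close>, \<open>a + r\<close> and \<open>a + \<i> r\<close> is an eigenvector of both \<open>a\<close> and
\<open>a\<^sup>*\<close>, with eigenvalues that do not depend on the vector. In dimension 2 this makes \<open>a\<close> scalar; in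
dimension 3 it makes \<open>a\<close> normal, hence scalar by hypothesis. Both contradict the choice of \<open>a\<close>.

Consequently \<open>\<parallel>a \<xi>\<parallel>\<^sup>2\<close> comes arbitrarily close to \<open>\<parallel>a\<parallel>\<^sup>2\<close> for unit vectors \<open>\<xi>\<close> whose vector states
are peak states. Conversely \<open>\<psi>(a\<^sup>*a) \<le> \<parallel>a\<parallel>\<^sup>2\<close> for every state (\<open>state_le_op_norm\<close>). If \<open>A\<close> consists of
scalars, there is only one state.\<close>

section \<open>The complex inner product and adjoint matrices\<close>

text \<open>The inner product is conjugate linear in its first argument; its real part is the inner product that
the type of vectors carries as a Euclidean space.\<close>
definition cinner :: "complex^'n \<Rightarrow> complex^'n \<Rightarrow> complex"
  where "cinner x y = (\<Sum>i\<in>UNIV. cnj (x$i) * y$i)"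

lemma cinner_add_right: "cinner x (y + z) = cinner x y + cinner x z"
  by (simp add: cinner_def distrib_left sum.distrib)

lemma cinner_diff_right: "cinner x (y - z) = cinner x y - cinner x z"
  by (simp add: cinner_def right_diff_distrib sum_subtractf)

lemma cinner_scale_right: "cinner x (c *s y) = c * cinner x y"
  by (simp add: cinner_def sum_distrib_left mult_ac)

lemma cinner_scale_left: "cinner (c *s x) y = cnj c * cinner x y"
  by (simp add: cinner_def sum_distrib_left mult_ac)

lemma cinner_zero_right [simp]: "cinner x 0 = 0"
  by (simp add: cinner_def)

lemma cinner_zero_left [simp]: "cinner 0 x = 0"
  by (simp add: cinner_def)

lemma cinner_cnj: "cnj (cinner x y) = cinner y x"
  by (simp add: cinner_def mult_ac)

lemma cinner_eq_0_sym: "cinner x y = 0 \<longleftrightarrow> cinner y x = 0"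
  by (metis cinner_cnj complex_cnj_zero_iff)

lemma Re_cinner: "Re (cinner x y) = x \<bullet> y"
  by (simp add: cinner_def inner_vec_def inner_complex_def)

lemma cinner_self: "cinner x x = of_real ((norm x)\<^sup>2)"
proof -
  have "Im (cinner x x) = 0"
    using cinner_cnj[of x x] by (metis complex_cnj_cancel_iff cnj.simps(2) equal_neg_zero)
  moreover have "Re (cinner x x) = (norm x)\<^sup>2"
    by (simp add: Re_cinner power2_norm_eq_inner)
  ultimately show ?thesis
    by (simp add: complex_eq_iff)
qed

lemma cinner_self_eq_0 [simp]: "cinner x x = 0 \<longleftrightarrow> x = 0"
  by (simp add: cinner_self)

lemma norm_scale: "norm (c *s x) = cmod c * norm (x :: complex^'n)"
proof -
  have "of_real ((norm (c *s x))\<^sup>2) = complex_of_real ((cmod c * norm x)\<^sup>2)"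
    unfolding cinner_self[symmetric] power_mult_distrib of_real_mult
    by (simp add: cinner_scale_left cinner_scale_right complex_norm_square[of c] mult_ac del: of_real_power)
  then have "(norm (c *s x))\<^sup>2 = (cmod c * norm x)\<^sup>2"
    using of_real_eq_iff by blast
  then show ?thesis
    by (simp add: power2_eq_iff_nonneg)
qed

lemma cinner_star: "cinner (star a *v x) y = cinner x (a *v y)"
proof -
  have "cinner (star a *v x) y = (\<Sum>j\<in>UNIV. \<Sum>i\<in>UNIV. cnj (x$i) * a$i$j * y$j)"
    by (simp add: cinner_def star_def matrix_vector_mult_def transpose_def sum_distrib_right
        sum_distrib_left mult_ac)
  also have "\<dots> = (\<Sum>i\<in>UNIV. \<Sum>j\<in>UNIV. cnj (x$i) * a$i$j * y$j)"
    by (rule sum.swap)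
  also have "\<dots> = cinner x (a *v y)"
    by (simp add: cinner_def matrix_vector_mult_def sum_distrib_left mult_ac)
  finally show ?thesis .
qed

lemma star_star [simp]: "star (star a) = a"
  by (simp add: star_def vec_eq_iff transpose_def)

lemma star_add: "star (a + b) = star a + star b"
  by (simp add: star_def vec_eq_iff transpose_def)

lemma star_mscale: "star (mscale c a) = mscale (cnj c) (star a)"
  by (simp add: star_def mscale_def vec_eq_iff transpose_def)

lemma star_mat_1 [simp]: "star (mat 1) = mat 1"
  by (simp add: star_def vec_eq_iff transpose_def mat_def)

lemma star_mult: "star (a ** b) = star b ** star a"
  by (simp add: star_def vec_eq_iff transpose_def matrix_matrix_mult_def mult_ac)

lemma cinner_star': "cinner (a *v x) y = cinner x (star a *v y)"
  using cinner_star[of "star a" x y] by simp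

lemma mscale_vector: "mscale c a *v x = c *s (a *v x)"
  by (simp add: mscale_def vec_eq_iff matrix_vector_mult_def sum_distrib_left mult_ac)

lemma mscale_mult_left: "mscale c a ** b = mscale c (a ** b)"
  by (simp add: mscale_def vec_eq_iff matrix_matrix_mult_def sum_distrib_left mult_ac)

lemma mscale_mult_right: "a ** mscale c b = mscale c (a ** b)"
  by (simp add: mscale_def vec_eq_iff matrix_matrix_mult_def sum_distrib_left mult_ac)

lemma mscale_mscale: "mscale c (mscale d a) = mscale (c * d) a"
  by (simp add: mscale_def vec_eq_iff)

lemma mscale_one [simp]: "mscale 1 a = a"
  by (simp add: mscale_def vec_eq_iff)

lemma mscale_of_real: "mscale (of_real r) a = r *\<^sub>R a"
  unfolding mscale_def vec_eq_iff by (simp add: scaleR_conv_of_real[where 'a = complex])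

lemma diff_eq_mscale: "a - b = a + mscale (-1) b"
  by (simp add: mscale_def vec_eq_iff)

section \<open>The operator norm and the vectors at which it is attained\<close>

lemma op_norm_nonneg: "0 \<le> op_norm a"
  unfolding op_norm_def by (rule onorm_pos_le) simp

lemma norm_le_op_norm: "norm (a *v x) \<le> op_norm a * norm (x :: complex^'n)"
  unfolding op_norm_def by (rule onorm) simp

lemma norm_star_le_op_norm: "norm (star a *v x) \<le> op_norm a * norm (x :: complex^'n)"
proof (cases "star a *v x = 0")
  case True
  then show ?thesis by (simp add: op_norm_nonneg)
next
  case False
  have "(norm (star a *v x))\<^sup>2 = x \<bullet> (a *v (star a *v x))"
    by (metis cinner_star Re_cinner power2_norm_eq_inner)
  also have "\<dots> \<le> norm x * norm (a *v (star a *v x))"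
    using Cauchy_Schwarz_ineq2[of x "a *v (star a *v x)"] by linarith
  also have "\<dots> \<le> norm x * (op_norm a * norm (star a *v x))"
    by (intro mult_left_mono norm_le_op_norm) simp
  finally have "norm (star a *v x) * norm (star a *v x) \<le> (op_norm a * norm x) * norm (star a *v x)"
    by (simp add: power2_eq_square mult_ac)
  then show ?thesis using False by simp
qed

lemma op_norm_attained:
  obtains x :: "complex^'n" where "norm x = 1" "norm (a *v x) = op_norm a"
proof -
  have ne: "sphere (0 :: complex^'n) 1 \<noteq> {}"
    by (metis axis_in_Basis_iff Basis_complex_def insertI1 norm_Basis empty_iff mem_sphere_0)
  have "continuous_on (sphere 0 1) (\<lambda>x :: complex^'n. norm (a *v x))"
    by (intro continuous_intros linear_continuous_on) simp
  then obtain x :: "complex^'n" where x: "x \<in> sphere 0 1"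
    and max: "\<And>y. y \<in> sphere 0 1 \<Longrightarrow> norm (a *v y) \<le> norm (a *v x)"
    using continuous_attains_sup[OF compact_sphere ne] by metis
  have "norm (a *v y) \<le> norm (a *v x) * norm y" for y
  proof (cases "y = 0")
    case False
    have "norm (a *v (complex_of_real (1 / norm y) *s y)) \<le> norm (a *v x)"
      using False by (intro max) (simp add: norm_scale norm_divide)
    then show ?thesis
      using False by (simp add: vector_scalar_commute norm_scale norm_divide field_simps)
  qed simp
  then have "op_norm a \<le> norm (a *v x)"
    unfolding op_norm_def by (intro onorm_le) 
  moreover have "norm (a *v x) \<le> op_norm a"
    using norm_le_op_norm[of a x] x by simp
  ultimately show ?thesis
    using x by (intro that[of x]) auto
qed

lemma op_norm_le: "(\<And>x. norm (a *v x) \<le> c * norm x) \<Longrightarrow> op_norm a \<le> c"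
  unfolding op_norm_def by (rule onorm_le)

definition norming :: "complex^'n^'n \<Rightarrow> complex^'n \<Rightarrow> bool"
  where "norming b x \<longleftrightarrow> norm (b *v x) = op_norm b * norm x"

text \<open>The eigenvector equation shows that the norming vectors form a subspace. It holds because
\<open>\<parallel>b\<^sup>*b x - m\<^sup>2 x\<parallel>\<^sup>2 = \<parallel>b\<^sup>*b x\<parallel>\<^sup>2 - 2 m\<^sup>2 \<parallel>b x\<parallel>\<^sup>2 + m\<^sup>4 \<parallel>x\<parallel>\<^sup>2\<close> with \<open>m = \<parallel>b\<parallel>\<close>, which is at most
\<open>m\<^sup>2 (m\<^sup>2 \<parallel>x\<parallel>\<^sup>2 - \<parallel>b x\<parallel>\<^sup>2)\<close>.\<close>
lemma norming_iff_eigen: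
  "norming b x \<longleftrightarrow> star b *v (b *v x) = of_real ((op_norm b)\<^sup>2) *s x"
proof
  let ?m = "op_norm b" and ?h = "star b *v (b *v x)"
  assume N: "norming b x"
  have h: "norm ?h \<le> ?m * (?m * norm x)"
    using norm_star_le_op_norm[of b "b *v x"] N by (simp add: norming_def)
  have ip: "?h \<bullet> x = (?m * norm x)\<^sup>2"
    using N cinner_star[of b "b *v x" x] Re_cinner
    by (metis norming_def power2_norm_eq_inner)
  have s: "(of_real (?m\<^sup>2) *s x) = ?m\<^sup>2 *\<^sub>R x"
    by (simp add: vec_eq_iff scaleR_conv_of_real[where 'a = complex])
  have "(norm (?h - ?m\<^sup>2 *\<^sub>R x))\<^sup>2 = (norm ?h)\<^sup>2 - 2 * ?m\<^sup>2 * (?h \<bullet> x) + (?m\<^sup>2)\<^sup>2 * (norm x)\<^sup>2"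
    unfolding power2_norm_eq_inner
    by (simp add: inner_diff_left inner_diff_right inner_commute power2_eq_square algebra_simps)
  also have "\<dots> \<le> 0"
    using power_mono[OF h, of 2] unfolding ip by (simp add: power2_eq_square algebra_simps)
  finally show "?h = of_real (?m\<^sup>2) *s x"
    unfolding s by simp
next
  assume E: "star b *v (b *v x) = of_real ((op_norm b)\<^sup>2) *s x"
  have "complex_of_real ((norm (b *v x))\<^sup>2) = cinner x (star b *v (b *v x))"
    by (simp only: cinner_self[symmetric] cinner_star')
  also have "\<dots> = of_real ((op_norm b * norm x)\<^sup>2)"
    unfolding E cinner_scale_right cinner_self by (simp add: power_mult_distrib)
  finally have "(norm (b *v x))\<^sup>2 = (op_norm b * norm x)\<^sup>2"
    using of_real_eq_iff by blast
  then show "norming b x"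
    by (simp add: norming_def power2_eq_iff_nonneg op_norm_nonneg)
qed

lemma norming_add: "norming b x \<Longrightarrow> norming b y \<Longrightarrow> norming b (x + y)"
  by (simp add: norming_iff_eigen matrix_vector_right_distrib vector_add_ldistrib)

lemma norming_scale: "norming b x \<Longrightarrow> norming b (c *s x)"
  by (simp add: norming_def vector_scalar_commute norm_scale)

text \<open>The vector \<open>\<xi>\<close> spans the norming vectors of \<open>b\<close>. Orthogonality replaces a dimension count: since the
norming vectors form a subspace, they are the multiples of \<open>\<xi>\<close> as soon as none but \<open>0\<close> is orthogonal
to \<open>\<xi>\<close>.\<close>
definition simple_norming :: "complex^'n^'n \<Rightarrow> complex^'n \<Rightarrow> bool"
  where "simple_norming b \<xi> \<longleftrightarrow> norm \<xi> = 1 \<and> norming b \<xi> \<and>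
    (\<forall>x. cinner \<xi> x = 0 \<longrightarrow> norming b x \<longrightarrow> x = 0)"

section \<open>Orthogonality in dimensions two and three\<close>

lemma orthogonal_card_le:
  fixes S :: "(complex^'n) set"
  assumes "finite S" "0 \<notin> S" "\<And>x y. x \<in> S \<Longrightarrow> y \<in> S \<Longrightarrow> x \<noteq> y \<Longrightarrow> cinner x y = 0"
  shows "card S \<le> CARD('n)"
proof -
  have "vec.independent S"
    using assms
  proof (induction S rule: finite_induct)
    case (insert x S)
    have "cinner x y = 0" if "y \<in> vec.span S" for y
      using that
    proof (induction rule: vec.span_induct_alt)
      case (step c u v)
      moreover have "cinner x u = 0"
        using insert step by auto
      ultimately show ?case
        by (simp add: cinner_add_right cinner_scale_right)
    qed simp
    then have "x \<notin> vec.span S"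
      using insert.prems(1) by (metis cinner_self_eq_0 insertI1)
    moreover have "vec.independent S"
      using insert by (intro insert.IH) auto
    ultimately show ?case
      by (rule vec.independent_insertI)
  qed (simp add: vec.independent_empty)
  then show ?thesis
    using vec.independent_card_le_dim[OF subset_UNIV] by (metis vec_dim_card)
qed

text \<open>The conditions on \<open>x\<close> are four real linear equations in six real unknowns.\<close>
lemma common_orthogonal_vector:
  fixes u v :: "complex^'n"
  assumes "CARD('n) = 3"
  obtains x where "x \<noteq> 0" "cinner u x = 0" "cinner v x = 0"
proof -
  let ?S = "{u, \<i> *s u, v, \<i> *s v}"
  have "dim ?S \<le> card ?S"
    by (rule dim_le_card') simp
  also have "\<dots> \<le> 4"
    by (simp add: card_insert_if)
  also have "\<dots> < DIM(complex^'n)"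
    using assms by simp
  finally obtain x where x: "x \<noteq> 0" "\<And>y. y \<in> span ?S \<Longrightarrow> orthogonal x y"
    by (rule orthogonal_to_subspace_exists) blast
  have "w \<bullet> x = 0" if "w \<in> ?S" for w
    using x(2)[OF span_base[OF that]] by (simp add: orthogonal_def inner_commute)
  then have "Re (cinner w x) = 0" if "w \<in> ?S" for w
    using that by (simp add: Re_cinner)
  moreover have "Re (cinner (\<i> *s w) x) = Im (cinner w x)" for w
    by (simp add: cinner_scale_left)
  ultimately have "cinner u x = 0" "cinner v x = 0"
    by (metis insertI1 insertI2 complex_eqI zero_complex.sel)+
  then show ?thesis
    using that x(1) by blast
qed

text \<open>If \<open>b\<close> has two orthogonal norming vectors \<open>u\<close> and \<open>v\<close>, then in dimension 3 they span the orthogonal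
complement of a vector \<open>w\<close>. A norming subspace of dimension at least two is best described by such a
\<open>w\<close>, because intersecting two of them then amounts to \<open>common_orthogonal_vector\<close>.\<close>
lemma norming_off_vector:
  fixes b :: "complex^'n^'n"
  assumes "CARD('n) = 3" "\<nexists>\<xi>. simple_norming b \<xi>"
  obtains w where "\<And>x. cinner w x = 0 \<Longrightarrow> norming b x"
proof -
  obtain u where u: "norm u = 1" "norming b u"
    using op_norm_attained[of b] by (auto simp: norming_def)
  then obtain v where v: "cinner u v = 0" "norming b v" "v \<noteq> 0"
    using assms(2) by (auto simp: simple_norming_def)
  obtain w where w: "w \<noteq> 0" "cinner u w = 0" "cinner v w = 0"
    using common_orthogonal_vector[OF assms(1)] .
  have "norming b x" if x: "cinner w x = 0" for x
  proof -
    define p where "p = (cinner u x / cinner u u) *s u + (cinner v x / cinner v v) *s v"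
    have u0: "u \<noteq> 0"
      using u(1) by auto
    have orth: "cinner v u = 0" "cinner w u = 0" "cinner w v = 0"
      using v(1) w(2,3) by (simp_all add: cinner_eq_0_sym[of v u] cinner_eq_0_sym[of w])
    have p: "cinner u (x - p) = 0" "cinner v (x - p) = 0" "cinner w (x - p) = 0"
      using u0 v w x orth
      by (simp_all add: p_def cinner_diff_right cinner_add_right cinner_scale_right)
    define y where "y = x - p"
    note p = p[folded y_def]
    have "y = 0"
    proof (rule ccontr)
      assume ne: "y \<noteq> 0"
      have "u \<noteq> v" "u \<noteq> w" "u \<noteq> y" "v \<noteq> w" "v \<noteq> y" "w \<noteq> y"
        using u0 v w p orth ne by auto
      then have "card {u, v, w, y} = 4"
        by simp
      moreover have "card {u, v, w, y} \<le> CARD('n)"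
        using u0 v w p orth ne
        by (intro orthogonal_card_le) (auto simp: cinner_eq_0_sym[of y])
      ultimately show False
        using assms(1) by simp
    qed
    then have "x = p"
      by (simp add: y_def)
    moreover have "norming b p"
      unfolding p_def by (intro norming_add norming_scale u v)
    ultimately show ?thesis
      by simp
  qed
  then show ?thesis
    by (rule that)
qed

lemma norming_everywhere:
  fixes b :: "complex^'n^'n"
  assumes "CARD('n) = 2" "\<nexists>\<xi>. simple_norming b \<xi>"
  shows "norming b x"
proof -
  obtain u where u: "norm u = 1" "norming b u"
    using op_norm_attained[of b] by (auto simp: norming_def)
  then obtain v where v: "cinner u v = 0" "norming b v" "v \<noteq> 0"
    using assms(2) by (auto simp: simple_norming_def)
  define p where "p = (cinner u x / cinner u u) *s u + (cinner v x / cinner v v) *s v"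
  have u0: "u \<noteq> 0"
    using u(1) by auto
  have orth: "cinner v u = 0"
    using v(1) by (simp add: cinner_eq_0_sym[of v u])
  have p: "cinner u (x - p) = 0" "cinner v (x - p) = 0"
    using u0 v orth
    by (simp_all add: p_def cinner_diff_right cinner_add_right cinner_scale_right)
  define y where "y = x - p"
  note p = p[folded y_def]
  have "y = 0"
  proof (rule ccontr)
    assume ne: "y \<noteq> 0"
    have "u \<noteq> v" "u \<noteq> y" "v \<noteq> y"
      using u0 v p orth ne by auto
    then have "card {u, v, y} = 3"
      by simp
    moreover have "card {u, v, y} \<le> CARD('n)"
      using u0 v p orth ne
      by (intro orthogonal_card_le) (auto simp: cinner_eq_0_sym[of y])
    ultimately show False
      using assms(1) by simp
  qed
  then have "x = p"
    by (simp add: y_def)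
  moreover have "norming b p"
    unfolding p_def by (intro norming_add norming_scale u v)
  ultimately show ?thesis
    by simp
qed

section \<open>Scalar perturbations\<close>

abbreviation shift :: "complex^'n^'n \<Rightarrow> complex \<Rightarrow> complex^'n^'n"
  where "shift a z \<equiv> a + mscale z (mat 1)"

lemma shift_vector: "shift a z *v x = a *v x + z *s x"
  by (simp add: matrix_vector_mult_add_rdistrib mscale_vector)

text \<open>Compare \<open>\<parallel>a + z\<parallel>\<^sup>2 + \<parallel>a - z\<parallel>\<^sup>2\<close> with \<open>2 \<parallel>a\<parallel>\<^sup>2 + 2 \<bar>z\<bar>\<^sup>2\<close> by means of the parallelogram law. At a
vector that is norming for \<open>a + z\<close> and \<open>a - z\<close> the law shows that the first quantity is at most the
second. At a norming vector \<open>x\<close> of \<open>a\<close> it then leaves no room for \<open>\<parallel>(a + z) x\<parallel> < \<parallel>a + z\<parallel> \<parallel>x\<parallel>\<close>.\<close>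
lemma norming_shift_off_vector:
  fixes a :: "complex^'n^'n"
  assumes "CARD('n) = 3"
    and "\<nexists>\<xi>. simple_norming (shift a z) \<xi>" "\<nexists>\<xi>. simple_norming (shift a (-z)) \<xi>"
    and a: "\<nexists>\<xi>. simple_norming a \<xi>" and w: "\<And>x. cinner w x = 0 \<Longrightarrow> norming a x"
    and x: "cinner w x = 0"
  shows "norming (shift a z) x"
proof -
  let ?m = "op_norm a" and ?p = "op_norm (shift a z)" and ?q = "op_norm (shift a (-z))"
  obtain u where u: "\<And>x. cinner u x = 0 \<Longrightarrow> norming (shift a z) x"
    using norming_off_vector[OF assms(1,2)] by metis
  obtain v where v: "\<And>x. cinner v x = 0 \<Longrightarrow> norming (shift a (-z)) x"
    using norming_off_vector[OF assms(1,3)] by metis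
  have par: "(norm (shift a z *v x))\<^sup>2 + (norm (shift a (-z) *v x))\<^sup>2
      = 2 * (norm (a *v x))\<^sup>2 + 2 * (cmod z)\<^sup>2 * (norm x)\<^sup>2" for x
  proof -
    have "(norm (s + t))\<^sup>2 + (norm (s - t))\<^sup>2 = 2 * (norm s)\<^sup>2 + 2 * (norm t)\<^sup>2" for s t :: "complex^'n"
      by (simp add: power2_norm_eq_inner inner_add_left inner_add_right inner_diff_left inner_diff_right)
    from this[of "a *v x" "z *s x"] show ?thesis
      unfolding shift_vector by (simp add: norm_scale power_mult_distrib)
  qed
  have le: "(norm (b *v x))\<^sup>2 \<le> (op_norm b)\<^sup>2 * (norm x)\<^sup>2" for b :: "complex^'n^'n" and x
    using power_mono[OF norm_le_op_norm, of b x 2] by (simp add: power_mult_distrib)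
  have eq: "(norm (b *v x))\<^sup>2 = (op_norm b)\<^sup>2 * (norm x)\<^sup>2" if "norming b x" for b :: "complex^'n^'n" and x
    using that by (simp add: norming_def power_mult_distrib)
  obtain y where y: "y \<noteq> 0" "cinner u y = 0" "cinner v y = 0"
    using common_orthogonal_vector[OF assms(1)] .
  have "(?p\<^sup>2 + ?q\<^sup>2) * (norm y)\<^sup>2 \<le> (2 * ?m\<^sup>2 + 2 * (cmod z)\<^sup>2) * (norm y)\<^sup>2"
    using par[of y] eq[OF u[OF y(2)]] eq[OF v[OF y(3)]] le[of a y] by (simp add: algebra_simps)
  then have 1: "?p\<^sup>2 + ?q\<^sup>2 \<le> 2 * ?m\<^sup>2 + 2 * (cmod z)\<^sup>2"
    using y(1) by simp
  have "(2 * ?m\<^sup>2 + 2 * (cmod z)\<^sup>2) * (norm x)\<^sup>2 \<le> (norm (shift a z *v x))\<^sup>2 + ?q\<^sup>2 * (norm x)\<^sup>2"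
    using par[of x] eq[OF w[OF x]] le[of "shift a (-z)" x] by (simp add: algebra_simps)
  moreover have "(?p\<^sup>2 + ?q\<^sup>2) * (norm x)\<^sup>2 \<le> (2 * ?m\<^sup>2 + 2 * (cmod z)\<^sup>2) * (norm x)\<^sup>2"
    using 1 by (rule mult_right_mono) simp
  ultimately have "(?p * norm x)\<^sup>2 \<le> (norm (shift a z *v x))\<^sup>2"
    by (simp add: algebra_simps power_mult_distrib)
  then have "?p * norm x \<le> norm (shift a z *v x)"
    by (rule power2_le_imp_le) simp
  then show ?thesis
    using norm_le_op_norm[of "shift a z" x] by (simp add: norming_def)
qed

text \<open>Since \<open>(a + z)\<^sup>*(a + z) = a\<^sup>*a + z a\<^sup>* + cnj z a + \<bar>z\<bar>\<^sup>2\<close>, a common eigenvector of \<open>a\<^sup>*a\<close> and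
\<open>(a + z)\<^sup>*(a + z)\<close> is an eigenvector of \<open>z a\<^sup>* + cnj z a\<close>. The choices \<open>z = r\<close> and \<open>z = \<i> r\<close> give
\<open>a\<^sup>* + a\<close> and \<open>a\<^sup>* - a\<close>, hence \<open>a\<close> and \<open>a\<^sup>*\<close>.\<close>
lemma common_norming_eigenvectors:
  fixes a :: "complex^'n^'n"
  assumes "r > 0"
  obtains \<alpha> \<beta> where "\<And>x. \<lbrakk>norming a x; norming (shift a (of_real r)) x; norming (shift a (\<i> * of_real r)) x\<rbrakk>
    \<Longrightarrow> a *v x = \<alpha> *s x \<and> star a *v x = \<beta> *s x"
proof -
  define m p q where "m = complex_of_real ((op_norm a)\<^sup>2)"
    and "p = complex_of_real ((op_norm (shift a (of_real r)))\<^sup>2)"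
    and "q = complex_of_real ((op_norm (shift a (\<i> * of_real r)))\<^sup>2)"
  let ?r = "complex_of_real r"
  define c d where "c = (p - m - ?r * ?r) / ?r" and "d = (q - m - ?r * ?r) / (\<i> * ?r)"
  have "a *v x = ((c - d) / 2) *s x \<and> star a *v x = ((c + d) / 2) *s x"
    if 0: "norming a x" and 1: "norming (shift a ?r) x" and 2: "norming (shift a (\<i> * ?r)) x" for x
  proof -
    let ?y = "a *v x" and ?z = "star a *v x"
    have exp: "star (shift a z) *v (shift a z *v x)
        = star a *v (a *v x) + z *s ?z + cnj z *s ?y + (z * cnj z) *s x" for z
      by (simp add: star_add star_mscale matrix_vector_mult_add_rdistrib mscale_vector
          matrix_vector_right_distrib vector_scalar_commute vector_add_ldistrib mult_ac)
    have "m *s x + ?r *s ?z + ?r *s ?y + (?r * ?r) *s x = p *s x"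
      using 1 0 exp[of ?r] unfolding norming_iff_eigen m_def p_def by simp
    then have 1: "?y $ i + ?z $ i = c * x $ i" for i
      using assms by (simp add: vec_eq_iff c_def field_simps)
    have "m *s x + (\<i> * ?r) *s ?z - (\<i> * ?r) *s ?y + (?r * ?r) *s x = q *s x"
      using 2 0 exp[of "\<i> * ?r"] unfolding norming_iff_eigen m_def q_def
      by (simp add: vec_eq_iff algebra_simps)
    then have 2: "?z $ i - ?y $ i = d * x $ i" for i
      using assms by (simp add: vec_eq_iff d_def field_simps)
    have "?y $ i = (c * x $ i - d * x $ i) / 2" "?z $ i = (c * x $ i + d * x $ i) / 2" for i
      unfolding 1[symmetric] 2[symmetric] by simp_all
    then show ?thesis
      by (simp add: vec_eq_iff left_diff_distrib distrib_right)
  qed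
  then show ?thesis
    by (rule that)
qed

text \<open>If \<open>a\<close> and \<open>a\<^sup>*\<close> act as scalars on the orthogonal complement of \<open>w\<close>, then both leave this complement
invariant, so both also leave its orthogonal complement, the line of \<open>w\<close>, invariant. Thus they commute
on both summands.\<close>
lemma normal_if_eigen_off_vector:
  fixes a :: "complex^'n^'n"
  assumes eig: "\<And>x. cinner w x = 0 \<Longrightarrow> a *v x = \<alpha> *s x \<and> star a *v x = \<beta> *s x"
  shows "normal_mat a"
proof -
  have onw: "\<exists>\<gamma>. b *v w = \<gamma> *s w"
    if "\<And>x. cinner w x = 0 \<Longrightarrow> star b *v x = \<delta> *s x" for b :: "complex^'n^'n" and \<delta>
  proof (cases "w = 0")
    case False
    define t where "t = b *v w - (cinner w (b *v w) / cinner w w) *s w"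
    have wt: "cinner w t = 0"
      using False by (simp add: t_def cinner_diff_right cinner_scale_right)
    then have tw: "cinner t w = 0"
      by (simp add: cinner_eq_0_sym)
    have "cinner t (b *v w) = 0"
      using that[OF wt] tw by (simp add: cinner_star[symmetric] cinner_scale_left)
    then have "cinner t t = 0"
      using tw by (subst (2) t_def) (simp add: cinner_diff_right cinner_scale_right)
    then show ?thesis
      by (auto simp: t_def)
  qed simp
  obtain \<gamma> \<delta> where w: "a *v w = \<gamma> *s w" "star a *v w = \<delta> *s w"
    using onw[of a] onw[of "star a"] eig by (metis star_star)
  have comm: "star a *v (a *v x) = a *v (star a *v x)" for x
  proof -
    define y where "y = x - (cinner w x / cinner w w) *s w"
    have "cinner w y = 0"
      by (cases "w = 0") (simp_all add: y_def cinner_diff_right cinner_scale_right)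
    then have "star a *v (a *v y) = a *v (star a *v y)"
      using eig by (simp add: vector_scalar_commute mult_ac)
    moreover have "star a *v (a *v w) = a *v (star a *v w)"
      using w by (simp add: vector_scalar_commute mult_ac)
    moreover have "x = y + (cinner w x / cinner w w) *s w"
      by (simp add: y_def)
    ultimately show ?thesis
      by (metis matrix_vector_right_distrib vector_scalar_commute)
  qed
  then show ?thesis
    unfolding normal_mat_def matrix_eq by (simp add: matrix_vector_mul_assoc[symmetric])
qed

lemma simple_norming_shift_3:
  fixes a :: "complex^'n^'n"
  assumes n: "CARD('n) = 3" and a: "\<not> normal_mat a" and r: "r > 0"
  obtains z \<xi> where "cmod z \<le> r" "simple_norming (shift a z) \<xi>"
proof (rule ccontr)
  assume "\<not> thesis"
  with that have no: "\<nexists>\<xi>. simple_norming (shift a z) \<xi>" if "cmod z \<le> r" for z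
    using \<open>cmod z \<le> r\<close> by blast
  have "shift a 0 = a"
    by (simp add: mscale_def vec_eq_iff)
  then have a0: "\<nexists>\<xi>. simple_norming a \<xi>"
    using no[of 0] r by simp
  obtain w where w: "\<And>x. cinner w x = 0 \<Longrightarrow> norming a x"
    using norming_off_vector[OF n a0] by metis
  obtain \<alpha> \<beta> where e: "\<And>x. \<lbrakk>norming a x; norming (shift a (of_real r)) x; norming (shift a (\<i> * of_real r)) x\<rbrakk>
    \<Longrightarrow> a *v x = \<alpha> *s x \<and> star a *v x = \<beta> *s x"
    using common_norming_eigenvectors[OF r] by metis
  have sh: "norming (shift a z) x" if "cmod z \<le> r" "cinner w x = 0" for z x
    using norming_shift_off_vector[OF n no no a0 w, of z] that by simp
  have "a *v x = \<alpha> *s x \<and> star a *v x = \<beta> *s x" if "cinner w x = 0" for x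
    using that r by (intro e w sh) (auto simp: norm_mult)
  then show False
    using normal_if_eigen_off_vector a by blast
qed

lemma simple_norming_shift_2:
  fixes a :: "complex^'n^'n"
  assumes n: "CARD('n) = 2" and a: "\<And>c. a \<noteq> mscale c (mat 1)" and r: "r > 0"
  obtains z \<xi> where "cmod z \<le> r" "simple_norming (shift a z) \<xi>"
proof (rule ccontr)
  assume "\<not> thesis"
  with that have no: "\<nexists>\<xi>. simple_norming (shift a z) \<xi>" if "cmod z \<le> r" for z
    using \<open>cmod z \<le> r\<close> by blast
  have sh: "norming (shift a z) x" if "cmod z \<le> r" for z x
    by (rule norming_everywhere[OF n no[OF that]])
  have "shift a 0 = a"
    by (simp add: mscale_def vec_eq_iff)
  then have w: "norming a x" for x
    using sh[of 0] r by simp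
  obtain \<alpha> \<beta> where e: "\<And>x. \<lbrakk>norming a x; norming (shift a (of_real r)) x; norming (shift a (\<i> * of_real r)) x\<rbrakk>
    \<Longrightarrow> a *v x = \<alpha> *s x \<and> star a *v x = \<beta> *s x"
    using common_norming_eigenvectors[OF r] by metis
  have "a *v x = \<alpha> *s x" for x
    using e[OF w sh sh] r by (simp add: norm_mult)
  then have "a = mscale \<alpha> (mat 1)"
    unfolding matrix_eq by (simp add: mscale_vector)
  then show False
    using a by blast
qed

section \<open>States\<close>

lemma subalgebraD:
  assumes "subalgebra B"
  shows "0 \<in> B" "\<And>a b. a \<in> B \<Longrightarrow> b \<in> B \<Longrightarrow> a + b \<in> B"
    "\<And>c a. a \<in> B \<Longrightarrow> mscale c a \<in> B" "\<And>a b. a \<in> B \<Longrightarrow> b \<in> B \<Longrightarrow> a ** b \<in> B"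
    "\<And>a b. a \<in> B \<Longrightarrow> b \<in> B \<Longrightarrow> a - b \<in> B"
  using assms unfolding subalgebra_def by (auto simp: diff_eq_mscale)

lemma subalgebra_closed:
  assumes "subalgebra B"
  shows "closed B"
proof -
  have "subspace B"
    using subalgebraD[OF assms] by (simp add: subspace_def mscale_of_real[symmetric])
  then show ?thesis
    by (rule closed_subspace)
qed

lemma stateD:
  assumes "\<psi> \<in> states B"
  shows "\<And>a b. a \<in> B \<Longrightarrow> b \<in> B \<Longrightarrow> \<psi> (a + b) = \<psi> a + \<psi> b"
    "\<And>c a. a \<in> B \<Longrightarrow> \<psi> (mscale c a) = c * \<psi> a"
    "\<And>b. b \<in> B \<Longrightarrow> \<psi> (star b ** b) \<in> \<real>\<^sub>\<ge>\<^sub>0"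
    "\<psi> (mat 1) = 1" "\<psi> \<in> extensional B"
  using assms unfolding states_def by auto

lemma state_diff:
  assumes "\<psi> \<in> states B" "subalgebra B" "a \<in> B" "b \<in> B"
  shows "\<psi> (a - b) = \<psi> a - \<psi> b"
  using stateD(1,2)[OF assms(1)] subalgebraD(3)[OF assms(2)] assms(3,4)
  by (simp add: diff_eq_mscale)

text \<open>Continuity of states comes from finite dimension: a real basis of \<open>B\<close> extends to one of all matrices.\<close>
lemma state_extends_bounded_linear:
  assumes \<psi>: "\<psi> \<in> states B" and B: "subalgebra B"
  obtains g where "bounded_linear g" "\<And>x. x \<in> B \<Longrightarrow> g x = \<psi> x"
proof -
  have scaleR: "r *\<^sub>R x \<in> B" "\<psi> (r *\<^sub>R x) = r *\<^sub>R \<psi> x" if "x \<in> B" for r x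
    using subalgebraD(3)[OF B that, of "of_real r"] stateD(2)[OF \<psi> that, of "of_real r"]
    by (simp_all add: mscale_of_real scaleR_conv_of_real[where 'a = complex])
  obtain S where S: "S \<subseteq> B" "independent S" "B \<subseteq> span S"
    using maximal_independent_subset[of B] by blast
  obtain g where g: "linear g" "\<And>x. x \<in> S \<Longrightarrow> g x = \<psi> x"
    using linear_independent_extend[OF S(2), of \<psi>] by blast
  have "x \<in> B \<and> g x = \<psi> x" if "x \<in> span S" for x
    using that
  proof (induction rule: span_induct_alt)
    case base
    have "\<psi> 0 = 0"
      using scaleR(2)[OF subalgebraD(1)[OF B], of 0] by simp
    then show ?case
      using linear_0[OF g(1)] subalgebraD(1)[OF B] by simp
  next
    case (step c x y)
    then have x: "x \<in> B" and y: "y \<in> B"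
      using S(1) by auto
    have "c *\<^sub>R x + y \<in> B"
      by (intro subalgebraD(2)[OF B] scaleR(1) x y)
    moreover have "\<psi> (c *\<^sub>R x + y) = c *\<^sub>R \<psi> x + \<psi> y"
      using stateD(1)[OF \<psi> scaleR(1)[OF x] y] scaleR(2)[OF x] by simp
    ultimately show ?case
      using step g by (simp add: linear_add linear_scale)
  qed
  then show ?thesis
    using that[of g] g(1) S(3) by (meson linear_conv_bounded_linear subsetD)
qed

text \<open>The powers \<open>y^(2^k)\<close>; only these occur because squaring preserves the inequality \<open>\<psi>(y) \<ge> 1\<close>.\<close>
fun repeated_square :: "complex^'n^'n \<Rightarrow> nat \<Rightarrow> complex^'n^'n" where
  "repeated_square y 0 = y"
| "repeated_square y (Suc k) = repeated_square y k ** repeated_square y k"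

lemma star_repeated_square: "star y = y \<Longrightarrow> star (repeated_square y k) = repeated_square y k"
  by (induction k) (simp_all add: star_mult)

lemma repeated_square_in: "subalgebra B \<Longrightarrow> y \<in> B \<Longrightarrow> repeated_square y k \<in> B"
  by (induction k) (simp_all add: subalgebraD)

text \<open>Positivity of \<open>\<psi>\<close> at \<open>(y - 1)\<^sup>*(y - 1) = y\<^sup>2 - 2 y + 1\<close>.\<close>
lemma state_square_ge:
  assumes \<psi>: "\<psi> \<in> states B" and B: "subalgebra B" "mat 1 \<in> B" and y: "y \<in> B" "star y = y"
  shows "Re (\<psi> (y ** y)) - 1 \<ge> 2 * (Re (\<psi> y) - 1)"
proof -
  let ?d = "y - mat 1"
  have st: "star ?d = ?d"
    using y(2) by (simp add: diff_eq_mscale star_add star_mscale)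
  have "?d ** ?d = (y ** y - mscale 2 y) + mat 1"
    by (simp add: matrix_eq matrix_vector_mul_assoc[symmetric] matrix_vector_mult_diff_rdistrib
        matrix_vector_mult_add_rdistrib matrix_vector_mult_diff_distrib mscale_vector)
      (simp add: vec_eq_iff)
  then have "\<psi> (?d ** ?d) = \<psi> (y ** y) - 2 * \<psi> y + 1"
    using \<psi> B y stateD[OF \<psi>] by (simp add: state_diff subalgebraD)
  moreover have "\<psi> (?d ** ?d) \<in> \<real>\<^sub>\<ge>\<^sub>0"
    using stateD(3)[OF \<psi>, of ?d] st B y by (simp add: subalgebraD)
  ultimately show ?thesis
    by (auto simp: complex_nonneg_Reals_iff)
qed

lemma state_repeated_square_ge:
  assumes "\<psi> \<in> states B" "subalgebra B" "mat 1 \<in> B" "y \<in> B" "star y = y"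
  shows "Re (\<psi> (repeated_square y k)) - 1 \<ge> 2 ^ k * (Re (\<psi> y) - 1)"
proof (induction k)
  case (Suc k)
  then show ?case
    using state_square_ge[OF assms(1-3), of "repeated_square y k"] assms star_repeated_square[of y k]
      repeated_square_in[of B y k] by simp
qed simp

definition normalized_gram :: "complex^'n^'n \<Rightarrow> complex^'n^'n"
  where "normalized_gram b = mscale (of_real (1 / (op_norm b)\<^sup>2)) (star b ** b)"

lemma star_normalized_gram: "star (normalized_gram b) = normalized_gram b"
  by (simp add: normalized_gram_def star_mscale star_mult)

lemma normalized_gram_vector: "normalized_gram b *v x = of_real (1 / (op_norm b)\<^sup>2) *s (star b *v (b *v x))"
  by (simp add: normalized_gram_def mscale_vector matrix_vector_mul_assoc)

lemma normalized_gram_contraction: "norm (normalized_gram b *v x) \<le> norm x"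
proof (cases "op_norm b = 0")
  case False
  have "norm (star b *v (b *v x)) \<le> op_norm b * (op_norm b * norm x)"
    by (rule order_trans[OF norm_star_le_op_norm mult_left_mono[OF norm_le_op_norm op_norm_nonneg]])
  then show ?thesis
    using False op_norm_nonneg[of b] unfolding normalized_gram_vector norm_scale norm_of_real
    by (simp add: pos_divide_le_eq power2_eq_square mult_ac less_le)
qed (simp add: normalized_gram_vector)

lemma repeated_square_contraction:
  assumes "\<And>x. norm (y *v x) \<le> norm x"
  shows "norm (repeated_square y k *v x) \<le> norm x"
proof (induction k arbitrary: x)
  case (Suc k)
  show ?case
    using order_trans[OF Suc Suc, of x] by (simp add: matrix_vector_mul_assoc[symmetric])
qed (simp add: assms)

lemma matrix_vector_axis: "((y :: complex^'n^'m) *v axis j 1) $ i = y $ i $ j"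
  by (simp add: matrix_vector_mult_def axis_def if_distrib cong: if_cong)

lemma norm_contraction_le:
  assumes "\<And>x. norm (y *v x) \<le> norm x"
  shows "norm (y :: complex^'n^'n) \<le> CARD('n) * CARD('n)"
proof -
  have "cmod (y $ i $ j) \<le> 1" for i j
  proof -
    have "cmod ((y *v axis j 1) $ i) \<le> norm (y *v axis j 1)"
      by (rule Finite_Cartesian_Product.norm_nth_le)
    then show ?thesis
      using assms[of "axis j 1"] by (simp add: matrix_vector_axis)
  qed
  then have "(\<Sum>i\<in>UNIV. \<Sum>j\<in>UNIV. cmod (y $ i $ j)) \<le> (\<Sum>i\<in>(UNIV::'n set). \<Sum>j\<in>(UNIV::'n set). 1)"
    by (intro sum_mono)
  moreover have "norm (y $ i) \<le> (\<Sum>j\<in>UNIV. cmod (y $ i $ j))" for i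
    unfolding norm_vec_def by (rule L2_set_le_sum) simp
  then have "(\<Sum>i\<in>UNIV. norm (y $ i)) \<le> (\<Sum>i\<in>UNIV. \<Sum>j\<in>UNIV. cmod (y $ i $ j))"
    by (intro sum_mono)
  moreover have "norm y \<le> (\<Sum>i\<in>UNIV. norm (y $ i))"
    by (subst norm_vec_def) (rule L2_set_le_sum, simp)
  ultimately show ?thesis
    by simp
qed

text \<open>Otherwise \<open>\<psi>(y) > 1\<close> for \<open>y = a\<^sup>*a / \<parallel>a\<parallel>\<^sup>2\<close>. Then the values \<open>\<psi>(y^(2^k))\<close> are unbounded by
\<open>state_repeated_square_ge\<close>, although the powers of the contraction \<open>y\<close> are bounded and \<open>\<psi>\<close> is
continuous. This argument replaces a square root of \<open>\<parallel>a\<parallel>\<^sup>2 - a\<^sup>*a\<close> in \<open>B\<close>.\<close>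
lemma state_le_op_norm:
  fixes a :: "complex^'n^'n"
  assumes \<psi>: "\<psi> \<in> states B" and B: "subalgebra B" "mat 1 \<in> B" and a: "star a ** a \<in> B"
  shows "Re (\<psi> (star a ** a)) \<le> (op_norm a)\<^sup>2"
proof (cases "op_norm a = 0")
  case True
  then have "a *v x = 0" for x
    using norm_le_op_norm[of a x] by simp
  then have "star a ** a = mscale 0 (mat 1)"
    unfolding matrix_eq by (simp add: matrix_vector_mul_assoc[symmetric] mscale_vector)
  then have "\<psi> (star a ** a) = 0"
    using stateD(2)[OF \<psi> B(2), of 0] by simp
  then show ?thesis
    by simp
next
  case False
  let ?y = "normalized_gram a"
  have y: "?y \<in> B"
    unfolding normalized_gram_def by (intro subalgebraD B a)
  obtain g where g: "bounded_linear g" "\<And>x. x \<in> B \<Longrightarrow> g x = \<psi> x"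
    using state_extends_bounded_linear[OF \<psi> B(1)] by blast
  obtain K where K: "\<And>x. norm (g x) \<le> norm x * K" "K > 0"
    using bounded_linear.pos_bounded[OF g(1)] by blast
  let ?C = "real (CARD('n) * CARD('n)) * K"
  have "2 ^ k * (Re (\<psi> ?y) - 1) \<le> ?C" for k
  proof -
    have "2 ^ k * (Re (\<psi> ?y) - 1) \<le> Re (\<psi> (repeated_square ?y k)) - 1"
      by (rule state_repeated_square_ge[OF \<psi> B y star_normalized_gram])
    also have "\<dots> \<le> norm (g (repeated_square ?y k))"
      using g(2)[OF repeated_square_in[OF B(1) y]] complex_Re_le_cmod[of "\<psi> (repeated_square ?y k)"] by simp
    also have "\<dots> \<le> norm (repeated_square ?y k) * K"
      by (rule K)
    also have "\<dots> \<le> ?C"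
      using K(2) by (intro mult_right_mono norm_contraction_le repeated_square_contraction normalized_gram_contraction) auto
    finally show ?thesis .
  qed
  note bd = this
  have "Re (\<psi> ?y) \<le> 1"
  proof (rule ccontr)
    assume "\<not> ?thesis"
    then have pos: "Re (\<psi> ?y) - 1 > 0"
      by simp
    obtain k where "?C / (Re (\<psi> ?y) - 1) < 2 ^ k"
      using real_arch_pow[of 2] by auto
    then show False
      using bd[of k] pos by (simp add: field_simps)
  qed
  moreover have "\<psi> ?y = of_real (1 / (op_norm a)\<^sup>2) * \<psi> (star a ** a)"
    unfolding normalized_gram_def by (rule stateD(2)[OF \<psi> a])
  then have "Re (\<psi> ?y) = Re (\<psi> (star a ** a)) / (op_norm a)\<^sup>2"
    by (simp del: of_real_divide of_real_power)
  ultimately show ?thesis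
    using False by (simp add: pos_divide_le_eq)
qed

section \<open>Peak states from one-dimensional spaces of norming vectors\<close>

text \<open>The matrix \<open>y = b\<^sup>*b / \<parallel>b\<parallel>\<^sup>2\<close> fixes \<open>\<xi>\<close> and maps the orthogonal complement of \<open>\<xi>\<close> to itself. There it
shrinks every nonzero vector strictly, hence by compactness by a common factor \<open>\<sigma> < 1\<close>.\<close>
lemma repeated_square_tendsto_projection:
  fixes b :: "complex^'n^'n"
  assumes \<xi>: "simple_norming b \<xi>" and b: "op_norm b > 0"
  obtains e where "(\<lambda>k. repeated_square (normalized_gram b) k) \<longlonglongrightarrow> e" "\<And>x. e *v x = cinner \<xi> x *s \<xi>"
proof -
  let ?y = "normalized_gram b"
  define e :: "complex^'n^'n" where "e = (\<chi> i j. \<xi> $ i * cnj (\<xi> $ j))"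
  have e: "e *v x = cinner \<xi> x *s \<xi>" for x
    by (simp add: vec_eq_iff e_def matrix_vector_mult_def cinner_def sum_distrib_left sum_distrib_right mult_ac)
  have n\<xi>: "norm \<xi> = 1" and norming: "norming b \<xi>"
    and simple: "\<And>x. cinner \<xi> x = 0 \<Longrightarrow> norming b x \<Longrightarrow> x = 0"
    using \<xi> by (auto simp: simple_norming_def)
  have y\<xi>: "?y *v \<xi> = \<xi>"
    using norming b unfolding norming_iff_eigen normalized_gram_vector by (simp add: vec_eq_iff)
  have sq\<xi>: "repeated_square ?y k *v \<xi> = \<xi>" for k
    by (induction k) (simp_all add: y\<xi> matrix_vector_mul_assoc[symmetric])
  have inv: "cinner \<xi> (repeated_square ?y k *v x) = cinner \<xi> x" for k x
    using cinner_star[of "repeated_square ?y k" \<xi> x] star_repeated_square[OF star_normalized_gram, of b k] by (simp add: sq\<xi>)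
  let ?S = "{x. cinner \<xi> x = 0} \<inter> sphere 0 1"
  \<comment> \<open>In dimension one the sphere in the complement is empty.\<close>
  obtain \<sigma> where \<sigma>: "0 \<le> \<sigma>" "\<sigma> < 1" "\<And>x. x \<in> ?S \<Longrightarrow> norm (?y *v x) \<le> \<sigma>"
  proof (cases "?S = {}")
    case True
    then show ?thesis
      using that[of 0] by auto
  next
    case False
    have "continuous_on UNIV (\<lambda>x. cinner \<xi> x)"
      unfolding cinner_def by (intro continuous_intros)
    then have "closed {x. cinner \<xi> x = 0}"
      by (intro closed_Collect_eq continuous_intros) auto
    then have "compact ?S"
      by (simp add: closed_Int_compact)
    moreover have "continuous_on ?S (\<lambda>x. norm (?y *v x))"
      by (intro continuous_intros linear_continuous_on) simp
    ultimately obtain x where x: "x \<in> ?S" "\<And>v. v \<in> ?S \<Longrightarrow> norm (?y *v v) \<le> norm (?y *v x)"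
      using continuous_attains_sup[OF _ False] by metis
    have "norm (?y *v x) < 1"
    proof (rule ccontr)
      assume "\<not> ?thesis"
      then have "norm (star b *v (b *v x)) \<ge> op_norm b * op_norm b"
        unfolding normalized_gram_vector norm_scale norm_of_real using b
        by (simp add: pos_le_divide_eq power2_eq_square)
      also have "norm (star b *v (b *v x)) \<le> op_norm b * norm (b *v x)"
        by (rule norm_star_le_op_norm)
      finally have "op_norm b \<le> norm (b *v x)"
        using b by simp
      then have "norming b x"
        using x(1) norm_le_op_norm[of b x] by (simp add: norming_def)
      then show False
        using simple x(1) by force
    qed
    then show ?thesis
      using x(2) by (intro that[of "norm (?y *v x)"]) auto
  qed
  have y\<sigma>: "norm (?y *v x) \<le> \<sigma> * norm x" if "cinner \<xi> x = 0" for x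
  proof (cases "x = 0")
    case False
    have "norm (?y *v (complex_of_real (1 / norm x) *s x)) \<le> \<sigma>"
      using False that by (intro \<sigma>(3)) (simp add: norm_scale norm_divide cinner_scale_right)
    then show ?thesis
      using False by (simp add: vector_scalar_commute norm_scale norm_divide field_simps)
  qed simp
  have sq: "norm (repeated_square ?y k *v x) \<le> \<sigma> ^ (2 ^ k) * norm x" if "cinner \<xi> x = 0" for k x
    using that
  proof (induction k arbitrary: x)
    case (Suc k)
    have "norm (repeated_square ?y (Suc k) *v x) \<le> \<sigma> ^ (2 ^ k) * norm (repeated_square ?y k *v x)"
      using Suc.IH[of "repeated_square ?y k *v x"] Suc.prems by (simp add: matrix_vector_mul_assoc[symmetric] inv)
    also have "\<dots> \<le> \<sigma> ^ (2 ^ k) * (\<sigma> ^ (2 ^ k) * norm x)"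
      by (intro mult_left_mono Suc) (simp add: \<sigma>)
    also have "\<dots> = \<sigma> ^ (2 ^ Suc k) * norm x"
      by (simp add: power_add[symmetric] mult.assoc[symmetric] mult_2)
    finally show ?case .
  qed (simp add: y\<sigma>)
  have "(\<lambda>k. \<sigma> ^ (2 ^ k)) \<longlonglongrightarrow> 0"
  proof (rule tendsto_sandwich[OF _ _ tendsto_const])
    show "(\<lambda>k. \<sigma> ^ k) \<longlonglongrightarrow> 0"
      using \<sigma> by (intro LIMSEQ_power_zero) simp
    show "\<forall>\<^sub>F k in sequentially. \<sigma> ^ (2 ^ k) \<le> \<sigma> ^ k"
      using \<sigma> less_exp by (intro always_eventually allI power_decreasing) (auto intro: less_imp_le)
  qed (use \<sigma> in auto)
  note lim0 = this
  have lim: "(\<lambda>k. repeated_square ?y k *v x) \<longlonglongrightarrow> e *v x" for x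
  proof -
    let ?x = "x - cinner \<xi> x *s \<xi>"
    have orth: "cinner \<xi> ?x = 0"
      by (simp add: cinner_diff_right cinner_scale_right cinner_self n\<xi>)
    have "repeated_square ?y k *v x - e *v x = repeated_square ?y k *v ?x" for k
      by (simp add: matrix_vector_mult_diff_distrib vector_scalar_commute sq\<xi> e)
    then have bd: "norm (repeated_square ?y k *v x - e *v x) \<le> \<sigma> ^ (2 ^ k) * norm ?x" for k
      using sq[OF orth] by simp
    have "(\<lambda>k. \<sigma> ^ (2 ^ k) * norm ?x) \<longlonglongrightarrow> 0"
      by (rule tendsto_mult_left_zero[OF lim0])
    then have "(\<lambda>k. repeated_square ?y k *v x - e *v x) \<longlonglongrightarrow> 0"
      by (rule Lim_null_comparison[OF always_eventually[OF allI[OF bd]]])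
    then show ?thesis
      by (rule LIM_zero_cancel)
  qed
  have "(\<lambda>k. repeated_square ?y k $ i $ j) \<longlonglongrightarrow> e $ i $ j" for i j
    using tendsto_vec_nth[OF lim[of "axis j 1"], of i] by (simp add: matrix_vector_axis)
  then have "(\<lambda>k. repeated_square ?y k) \<longlonglongrightarrow> e"
    by (intro vec_tendstoI)
  then show ?thesis
    using e by (rule that)
qed

text \<open>A form of the Cauchy-Schwarz inequality: \<open>\<psi>((x + c g)\<^sup>*(x + c g))\<close> is an affine function of the real and
imaginary parts of \<open>c\<close> that takes no negative value, so it is constant.\<close>
lemma state_null_ideal:
  assumes \<psi>: "\<psi> \<in> states B" and B: "cstar_subalgebra B" and g: "g \<in> B" "\<psi> (star g ** g) = 0"
    and x: "x \<in> B"
  shows "\<psi> (star g ** x) = 0" "\<psi> (x ** g) = 0"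
proof -
  have sub: "subalgebra B" and st: "\<And>b. b \<in> B \<Longrightarrow> star b \<in> B"
    using B by (auto simp: cstar_subalgebra_def)
  note B' = subalgebraD[OF sub] st
  have main: "\<psi> (star g ** x) = 0 \<and> \<psi> (star x ** g) = 0" if x: "x \<in> B" for x
  proof -
    let ?k = "\<psi> (star x ** x)" and ?p = "\<psi> (star x ** g)" and ?q = "\<psi> (star g ** x)"
    have pos: "?k + c * ?p + cnj c * ?q \<in> \<real>\<^sub>\<ge>\<^sub>0" for c
    proof -
      let ?v = "x + mscale c g"
      have "star ?v ** ?v = star x ** x + mscale c (star x ** g) + mscale (cnj c) (star g ** x)
          + mscale (c * cnj c) (star g ** g)"
        by (simp add: star_add star_mscale matrix_eq matrix_vector_mul_assoc[symmetric]
            matrix_vector_mult_add_rdistrib matrix_vector_right_distrib mscale_vector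
            vector_scalar_commute vector_add_ldistrib mult_ac)
      then have "\<psi> (star ?v ** ?v) = ?k + c * ?p + cnj c * ?q"
        using B' g x stateD(1,2)[OF \<psi>] by simp
      moreover have "\<psi> (star ?v ** ?v) \<in> \<real>\<^sub>\<ge>\<^sub>0"
        using B' g x by (intro stateD(3)[OF \<psi>]) simp
      ultimately show ?thesis
        by simp
    qed
    have lin: "u = 0" if "\<And>t :: real. ?k + of_real t * u \<in> \<real>\<^sub>\<ge>\<^sub>0" for u
    proof -
      have k: "Im ?k = 0"
        using that[of 0] by (simp add: complex_nonneg_Reals_iff)
      have "Im u = 0"
        using that[of 1] k by (simp add: complex_nonneg_Reals_iff)
      moreover have "Re u = 0"
      proof (rule ccontr)
        assume "Re u \<noteq> 0"
        then show False
          using that[of "- (Re ?k + 1) / Re u"] by (simp add: complex_nonneg_Reals_iff)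
      qed
      ultimately show ?thesis
        by (simp add: complex_eq_iff)
    qed
    have "?p + ?q = 0"
      using pos[of "of_real _"] by (intro lin) (simp add: algebra_simps)
    moreover have "\<i> * (?p - ?q) = 0"
      using pos[of "\<i> * of_real _"] by (intro lin) (simp add: algebra_simps)
    ultimately show ?thesis
      by (simp add: eq_neg_iff_add_eq_0[symmetric])
  qed
  show "\<psi> (star g ** x) = 0"
    using main x by blast
  show "\<psi> (x ** g) = 0"
    using main[of "star x"] st x by simp
qed

definition vector_state :: "(complex^'n^'n) set \<Rightarrow> complex^'n \<Rightarrow> complex^'n^'n \<Rightarrow> complex"
  where "vector_state B \<xi> = (\<lambda>x\<in>B. cinner \<xi> (x *v \<xi>))"

lemma vector_state_gram: "star a ** a \<in> B \<Longrightarrow> vector_state B \<xi> (star a ** a) = of_real ((norm (a *v \<xi>))\<^sup>2)"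
  by (simp add: vector_state_def matrix_vector_mul_assoc[symmetric] cinner_star'[symmetric] cinner_self)

lemma vector_state_is_state:
  assumes B: "cstar_subalgebra B" "mat 1 \<in> B" and \<xi>: "norm \<xi> = 1"
  shows "vector_state B \<xi> \<in> states B"
proof -
  have sub: "subalgebra B" and st: "\<And>b. b \<in> B \<Longrightarrow> star b \<in> B"
    using B by (auto simp: cstar_subalgebra_def)
  show ?thesis
    unfolding states_def
  proof (intro CollectI conjI ballI allI)
    fix b assume "b \<in> B"
    then have "star b ** b \<in> B"
      using sub st by (simp add: subalgebraD)
    then show "vector_state B \<xi> (star b ** b) \<in> \<real>\<^sub>\<ge>\<^sub>0"
      by (simp add: vector_state_gram)
  qed (use B(2) \<xi> subalgebraD[OF sub] in \<open>simp_all add: vector_state_def matrix_vector_mult_add_rdistrib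
      cinner_add_right mscale_vector cinner_scale_right cinner_self\<close>)
qed

text \<open>By \<open>state_repeated_square_ge\<close> and continuity, \<open>\<psi>\<close> takes the value \<open>1\<close> at the limit projection \<open>e\<close>, so it
vanishes at \<open>f = 1 - e = f\<^sup>*f\<close>. By \<open>state_null_ideal\<close>, \<open>\<psi>\<close> ignores the last two summands of
\<open>x = e x e + f x e + x f\<close>.\<close>
lemma state_eq_vector_state:
  assumes \<psi>: "\<psi> \<in> states B" and B: "cstar_subalgebra B" "mat 1 \<in> B"
    and b: "normalized_gram b \<in> B" "simple_norming b \<xi>" "op_norm b > 0" and ge: "Re (\<psi> (normalized_gram b)) \<ge> 1"
  shows "\<psi> = vector_state B \<xi>"
proof -
  let ?y = "normalized_gram b"
  have sub: "subalgebra B" and st: "\<And>b. b \<in> B \<Longrightarrow> star b \<in> B" and cl: "closed B"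
    using B by (auto simp: cstar_subalgebra_def)
  note B' = subalgebraD[OF sub] st
  have \<xi>: "norm \<xi> = 1"
    using b(2) by (simp add: simple_norming_def)
  obtain e where e: "(\<lambda>k. repeated_square ?y k) \<longlonglongrightarrow> e" and ev: "\<And>x. e *v x = cinner \<xi> x *s \<xi>"
    using repeated_square_tendsto_projection[OF b(2,3)] by blast
  have eB: "e \<in> B"
    using cl e repeated_square_in[OF sub b(1)] by (metis closed_sequentially)
  obtain g where g: "bounded_linear g" "\<And>x. x \<in> B \<Longrightarrow> g x = \<psi> x"
    using state_extends_bounded_linear[OF \<psi> sub] by blast
  have "(\<lambda>k. g (repeated_square ?y k)) \<longlonglongrightarrow> g e"
    by (rule bounded_linear.tendsto[OF g(1) e])
  then have "(\<lambda>k. Re (\<psi> (repeated_square ?y k))) \<longlonglongrightarrow> Re (\<psi> e)"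
    using g(2) repeated_square_in[OF sub b(1)] eB by (intro tendsto_Re) simp
  moreover have "Re (\<psi> (repeated_square ?y k)) \<ge> 1" for k
  proof -
    have "0 \<le> 2 ^ k * (Re (\<psi> ?y) - 1)"
      using ge by simp
    then show ?thesis
      using state_repeated_square_ge[OF \<psi> sub B(2) b(1) star_normalized_gram, of k] by linarith
  qed
  ultimately have e1: "Re (\<psi> e) \<ge> 1"
    by (intro LIMSEQ_le_const) auto
  define f where "f = mat 1 - e"
  have fv: "f *v x = x - cinner \<xi> x *s \<xi>" for x
    by (simp add: f_def matrix_vector_mult_diff_rdistrib ev)
  have fB: "f \<in> B"
    using B' eB B(2) by (simp add: f_def)
  have "star e = e"
  proof -
    have "cinner x (star e *v v) = cinner x (e *v v)" for x v
      by (simp add: cinner_star'[symmetric] ev cinner_scale_left cinner_scale_right cinner_cnj)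
    then have "cinner (star e *v v - e *v v) (star e *v v - e *v v) = 0" for v
      by (simp only: cinner_diff_right) simp
    then show ?thesis
      unfolding matrix_eq cinner_self_eq_0 by simp
  qed
  then have sf: "star f = f"
    by (simp add: f_def diff_eq_mscale star_add star_mscale)
  have ff: "star f ** f = f"
    unfolding sf matrix_eq
    by (simp add: matrix_vector_mul_assoc[symmetric] fv cinner_diff_right cinner_scale_right cinner_self \<xi>)
  have "\<psi> f \<in> \<real>\<^sub>\<ge>\<^sub>0"
    using stateD(3)[OF \<psi> fB] ff by simp
  moreover have \<psi>f: "\<psi> f = 1 - \<psi> e"
    unfolding f_def using state_diff[OF \<psi> sub B(2) eB] stateD(4)[OF \<psi>] by simp
  ultimately have \<psi>f0: "\<psi> f = 0"
    using e1 by (auto simp: complex_nonneg_Reals_iff complex_eq_iff)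
  then have \<psi>e: "\<psi> e = 1"
    using \<psi>f by simp
  have null: "\<psi> (f ** x) = 0" "\<psi> (x ** f) = 0" if "x \<in> B" for x
    using state_null_ideal[OF \<psi> B(1) fB _ that] \<psi>f0 ff sf by simp_all
  have "\<psi> x = cinner \<xi> (x *v \<xi>)" if x: "x \<in> B" for x
  proof -
    have "x = (mscale (cinner \<xi> (x *v \<xi>)) e + f ** (x ** e)) + x ** f"
      unfolding matrix_eq
      by (simp add: matrix_vector_mult_add_rdistrib matrix_vector_mul_assoc[symmetric] fv ev mscale_vector
          vector_scalar_commute matrix_vector_mult_diff_distrib cinner_scale_right cinner_diff_right mult_ac)
    then have "\<psi> x = \<psi> ((mscale (cinner \<xi> (x *v \<xi>)) e + f ** (x ** e)) + x ** f)"
      by simp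
    also have "\<dots> = cinner \<xi> (x *v \<xi>)"
      using x eB fB null B' by (simp add: stateD(1,2)[OF \<psi>] \<psi>e)
    finally show ?thesis .
  qed
  then show ?thesis
    using stateD(5)[OF \<psi>] by (intro extensionalityI[of _ B]) (auto simp: vector_state_def)
qed

text \<open>The element \<open>y\<close> that peaks is \<open>c\<^sup>*c\<close> with \<open>c = b / \<parallel>b\<parallel>\<close>.\<close>
lemma simple_norming_peaks:
  assumes A: "subalgebra A" "A \<subseteq> B" and B: "cstar_subalgebra B" "mat 1 \<in> B"
    and b: "b \<in> A" "simple_norming b \<xi>" "op_norm b > 0"
  shows "vector_state B \<xi> \<in> Q_peak_states A B"
proof -
  have sub: "subalgebra B" and st: "\<And>b. b \<in> B \<Longrightarrow> star b \<in> B"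
    using B by (auto simp: cstar_subalgebra_def)
  let ?c = "mscale (of_real (1 / op_norm b)) b"
  have c: "?c \<in> A"
    using subalgebraD(3)[OF A(1) b(1)] .
  have y: "star ?c ** ?c = normalized_gram b"
    by (simp add: star_mscale mscale_mult_left mscale_mult_right mscale_mscale normalized_gram_def power2_eq_square)
  have yB: "normalized_gram b \<in> B"
    unfolding y[symmetric] using sub st c A(2) by (intro subalgebraD(4)) auto
  have \<xi>: "norm \<xi> = 1" "norming b \<xi>"
    using b(2) by (auto simp: simple_norming_def)
  have "vector_state B \<xi> (normalized_gram b) = 1"
    using yB \<xi> b(3) unfolding norming_iff_eigen
    by (simp add: vector_state_def normalized_gram_vector cinner_scale_right cinner_self)
  moreover have "cmod (\<psi> (normalized_gram b)) < 1" if \<psi>: "\<psi> \<in> states B" and ne: "\<psi> \<noteq> vector_state B \<xi>" for \<psi>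
  proof (rule ccontr)
    assume "\<not> ?thesis"
    moreover have "\<psi> (normalized_gram b) \<in> \<real>\<^sub>\<ge>\<^sub>0"
      using stateD(3)[OF \<psi>, of ?c] y c A(2) by auto
    ultimately have "Re (\<psi> (normalized_gram b)) \<ge> 1"
      by (auto simp: complex_nonneg_Reals_iff cmod_eq_Re)
    then show False
      using state_eq_vector_state[OF \<psi> B yB b(2,3)] ne by blast
  qed
  moreover have "normalized_gram b \<in> Q_set A"
    unfolding Q_set_def y[symmetric] by (rule imageI[OF c])
  ultimately show ?thesis
    unfolding Q_peak_states_def using vector_state_is_state[OF B \<xi>(1)] by blast
qed


section \<open>Density and the supremum\<close>

lemma cstar_generated_properties:
  assumes "B = cstar_generated A"
  shows "cstar_subalgebra B" "A \<subseteq> B"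
proof -
  show "A \<subseteq> B"
    using assms by (auto simp: cstar_generated_def)
  have "closed B"
    unfolding assms cstar_generated_def by (intro closed_Inter) (auto simp: cstar_subalgebra_def)
  moreover have "subalgebra B"
    unfolding assms cstar_generated_def subalgebra_def by (auto simp: cstar_subalgebra_def subalgebraD)
  moreover have "\<forall>b\<in>B. star b \<in> B"
    unfolding assms cstar_generated_def by (auto simp: cstar_subalgebra_def)
  ultimately show "cstar_subalgebra B"
    by (simp add: cstar_subalgebra_def)
qed

lemma scalar_if_card_1:
  fixes a :: "complex^'n^'n"
  assumes "CARD('n) = 1"
  shows "\<exists>c. a = mscale c (mat 1)"
proof -
  obtain i :: 'n where i: "\<And>j. j = i"
    using assms by (metis card_1_singletonE UNIV_I singletonD)
  have "a = mscale (a $ i $ i) (mat 1)"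
    unfolding vec_eq_iff by (simp add: mscale_def mat_def) (metis i)
  then show ?thesis ..
qed

text \<open>A scalar \<open>a\<close> is first moved off the scalars by a small multiple of the given non-scalar \<open>s\<close>; then a small
scalar is added to make the norming space one-dimensional.\<close>
lemma simple_norming_approximation:
  fixes A :: "(complex^'n^'n) set"
  assumes A: "unital_subalgebra A"
    and n: "CARD('n) = 2 \<or>
         (CARD('n) = 3 \<and> (\<forall>a\<in>A. normal_mat a \<longrightarrow> (\<exists>c. a = mscale c (mat 1))))"
    and ns: "s \<in> A" "\<And>c. s \<noteq> mscale c (mat 1)"
    and a: "a \<in> A" and r: "r > 0"
  obtains b \<xi> where "b \<in> A" "simple_norming b \<xi>" "op_norm b > 0"
    "\<And>x. norm (a *v x - b *v x) \<le> r * norm x"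
proof -
  have sub: "subalgebra A" and one: "mat 1 \<in> A"
    using A by (auto simp: unital_subalgebra_def)
  obtain a' where a': "a' \<in> A" "\<And>c. a' \<noteq> mscale c (mat 1)"
    "\<And>x. norm (a *v x - a' *v x) \<le> r / 2 * norm x"
  proof (cases "\<exists>c. a = mscale c (mat 1)")
    case False
    then show ?thesis
      using that[of a] a r by auto
  next
    case True
    then obtain c where c: "a = mscale c (mat 1)" ..
    \<comment> \<open>The summand 1 keeps the denominator positive.\<close>
    define t where "t = r / (2 * (op_norm s + 1))"
    have t: "t > 0"
      using r op_norm_nonneg[of s] by (simp add: t_def)
    let ?a = "a + mscale (of_real t) s"
    show ?thesis
    proof (rule that[of ?a])
      show "?a \<in> A"
        using sub a ns(1) by (simp add: subalgebraD)
      show "?a \<noteq> mscale d (mat 1)" for d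
      proof
        assume "?a = mscale d (mat 1)"
        then have "mscale (of_real t) s = mscale (d - c) (mat 1)"
          unfolding c by (simp add: mscale_def vec_eq_iff algebra_simps)
        then have "mscale (of_real (1 / t)) (mscale (of_real t) s) = mscale (of_real (1 / t) * (d - c)) (mat 1)"
          by (simp only: mscale_mscale)
        then have "s = mscale (of_real (1 / t) * (d - c)) (mat 1)"
          using t by (simp add: mscale_mscale)
        then show False
          using ns(2) by blast
      qed
      fix x
      have "norm (a *v x - ?a *v x) = t * norm (s *v x)"
        using t by (simp add: matrix_vector_mult_add_rdistrib mscale_vector norm_scale)
      also have "\<dots> \<le> t * ((op_norm s + 1) * norm x)"
        using norm_le_op_norm[of s x] t by (intro mult_left_mono) (auto simp: algebra_simps intro: order_trans)
      also have "\<dots> = r / 2 * norm x"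
        using op_norm_nonneg[of s] by (simp add: t_def field_simps)
      finally show "norm (a *v x - ?a *v x) \<le> r / 2 * norm x" .
    qed
  qed
  have "\<exists>z \<xi>. cmod z \<le> r / 2 \<and> simple_norming (shift a' z) \<xi>"
    using n
  proof
    assume "CARD('n) = 2"
    then show ?thesis
      using simple_norming_shift_2[of a' "r / 2"] a'(2) r by (metis half_gt_zero)
  next
    assume n3: "CARD('n) = 3 \<and> (\<forall>a\<in>A. normal_mat a \<longrightarrow> (\<exists>c. a = mscale c (mat 1)))"
    then have "\<not> normal_mat a'"
      using a'(1,2) by blast
    then show ?thesis
      using simple_norming_shift_3[of a' "r / 2"] n3 r by (metis half_gt_zero)
  qed
  then obtain z \<xi> where z: "cmod z \<le> r / 2" "simple_norming (shift a' z) \<xi>"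
    by blast
  have "op_norm (shift a' z) \<noteq> 0"
  proof
    assume "op_norm (shift a' z) = 0"
    then have "a' *v x + z *s x = 0" for x
      using norm_le_op_norm[of "shift a' z" x] by (simp add: shift_vector)
    then have "a' *v x = (- z) *s x" for x
      by (simp add: add_eq_0_iff2 vec.scale_minus_left)
    then have "a' = mscale (- z) (mat 1)"
      unfolding matrix_eq mscale_vector by simp
    then show False
      using a'(2) by blast
  qed
  then have pos: "op_norm (shift a' z) > 0"
    using op_norm_nonneg[of "shift a' z"] by simp
  have "norm (a *v x - shift a' z *v x) \<le> r * norm x" for x
  proof -
    have "norm (a *v x - shift a' z *v x) = norm ((a *v x - a' *v x) - z *s x)"
      unfolding shift_vector by (simp add: algebra_simps)
    also have "\<dots> \<le> norm (a *v x - a' *v x) + cmod z * norm x"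
      using norm_triangle_ineq4[of "a *v x - a' *v x" "z *s x"] by (simp add: norm_scale)
    also have "\<dots> \<le> r / 2 * norm x + r / 2 * norm x"
      by (intro add_mono a'(3) mult_right_mono z) simp
    finally show ?thesis
      by (simp add: field_simps)
  qed
  then show ?thesis
    using that[of "shift a' z" \<xi>] z(2) pos sub one a'(1) by (simp add: subalgebraD)
qed

text \<open>An algebra of scalars generates only itself, and all states agree on the scalars; the identity serves as
peaking element.\<close>
lemma peak_states_of_scalars:
  fixes A B :: "(complex^'n^'n) set"
  assumes A: "unital_subalgebra A" and B: "B = cstar_generated A"
    and sc: "\<And>a. a \<in> A \<Longrightarrow> \<exists>c. a = mscale c (mat 1)" and \<xi>: "norm \<xi> = 1"
  shows "vector_state B \<xi> \<in> Q_peak_states A B"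
proof -
  have sub: "subalgebra A" and one: "mat 1 \<in> A"
    using A by (auto simp: unital_subalgebra_def)
  have AB: "A \<subseteq> B" and cs: "cstar_subalgebra B"
    using cstar_generated_properties[OF B] by auto
  have eq: "A = range (\<lambda>c. mscale c (mat 1))"
    using sc subalgebraD(3)[OF sub one] by auto
  have "star a \<in> A" if "a \<in> A" for a
    using sc[OF that] by (auto simp: star_mscale intro: subalgebraD(3)[OF sub one])
  moreover have "closed A"
    by (rule subalgebra_closed[OF sub])
  ultimately have "cstar_subalgebra A"
    using sub by (simp add: cstar_subalgebra_def)
  then have BA: "B = A"
    using AB unfolding B cstar_generated_def by blast
  have st: "vector_state B \<xi> \<in> states B"
    using vector_state_is_state[OF cs _ \<xi>] one AB by blast
  have unique: "\<psi> = vector_state B \<xi>" if \<psi>: "\<psi> \<in> states B" for \<psi>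
  proof (rule extensionalityI[of _ B])
    fix x assume "x \<in> B"
    then obtain c where "x = mscale c (mat 1)"
      using sc BA by blast
    then show "\<psi> x = vector_state B \<xi> x"
      using stateD(2,4)[OF \<psi>] stateD(2,4)[OF st] one BA by simp
  qed (use stateD(5)[OF \<psi>] stateD(5)[OF st] in auto)
  have "mat 1 \<in> Q_set A"
    unfolding Q_set_def using one by (intro image_eqI[of _ _ "mat 1"]) auto
  then show ?thesis
    unfolding Q_peak_states_def using st unique stateD(4)[OF st] by blast
qed

theorem corollary5p10:
  fixes A B :: "(complex^'n^'n) set"
  assumes "unital_subalgebra A"
    and "B = cstar_generated A"
    and "CARD('n) \<le> 2 \<or>
         (CARD('n) = 3 \<and> (\<forall>a\<in>A. normal_mat a \<longrightarrow> (\<exists>c. a = mscale c (mat 1))))"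
  shows "\<forall>a\<in>A. (SUP \<omega>\<in>Q_peak_states A B. ereal (Re (\<omega> (star a ** a)))) = ereal ((op_norm a)\<^sup>2)"
proof
  fix a assume a: "a \<in> A"
  have sub: "subalgebra A" and one: "mat 1 \<in> A"
    using assms(1) by (auto simp: unital_subalgebra_def)
  have AB: "A \<subseteq> B" and cs: "cstar_subalgebra B"
    using cstar_generated_properties[OF assms(2)] by auto
  have subB: "subalgebra B" and oneB: "mat 1 \<in> B" and aaB: "star a ** a \<in> B"
    using cs AB one a by (auto simp: cstar_subalgebra_def subalgebraD)
  have approx: "\<exists>\<xi>. vector_state B \<xi> \<in> Q_peak_states A B \<and> op_norm a - r \<le> norm (a *v \<xi>)"
    if r: "r > 0" for r
  proof (cases "\<forall>s\<in>A. \<exists>c. s = mscale c (mat 1)")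
    case True
    obtain \<xi> where "norm \<xi> = 1" "norm (a *v \<xi>) = op_norm a"
      using op_norm_attained[of a] .
    then show ?thesis
      using peak_states_of_scalars[OF assms(1,2)] True r by (intro exI[of _ \<xi>]) auto
  next
    case False
    then obtain s where s: "s \<in> A" "\<And>c. s \<noteq> mscale c (mat 1)"
      by blast
    have "CARD('n) \<noteq> 1"
      using scalar_if_card_1[of s] s(2) by blast
    moreover have "CARD('n) > 0"
      by simp
    ultimately have n: "CARD('n) = 2 \<or>
         (CARD('n) = 3 \<and> (\<forall>a\<in>A. normal_mat a \<longrightarrow> (\<exists>c. a = mscale c (mat 1))))"
      using assms(3) by linarith
    obtain b \<xi> where b: "b \<in> A" "simple_norming b \<xi>" "op_norm b > 0"
      and close: "\<And>x. norm (a *v x - b *v x) \<le> r / 2 * norm x"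
      using simple_norming_approximation[OF assms(1) n s a, of "r / 2"] r by auto
    have \<xi>: "norm \<xi> = 1" "norm (b *v \<xi>) = op_norm b"
      using b(2) by (auto simp: simple_norming_def norming_def)
    have "op_norm a \<le> op_norm b + r / 2"
    proof (rule op_norm_le)
      fix x
      show "norm (a *v x) \<le> (op_norm b + r / 2) * norm x"
        using norm_triangle_sub[of "a *v x" "b *v x"] close[of x] norm_le_op_norm[of b x]
        by (simp add: algebra_simps)
    qed
    moreover have "norm (b *v \<xi>) \<le> norm (a *v \<xi>) + r / 2"
      using norm_triangle_sub[of "b *v \<xi>" "a *v \<xi>"] close[of \<xi>] \<xi>(1) by (simp add: norm_minus_commute)
    ultimately have "op_norm a - r \<le> norm (a *v \<xi>)"
      using \<xi>(2) by linarith
    then show ?thesis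
      using simple_norming_peaks[OF sub AB cs oneB b] by blast
  qed
  show "(SUP \<omega>\<in>Q_peak_states A B. ereal (Re (\<omega> (star a ** a)))) = ereal ((op_norm a)\<^sup>2)"
  proof (rule antisym)
    show "(SUP \<omega>\<in>Q_peak_states A B. ereal (Re (\<omega> (star a ** a)))) \<le> ereal ((op_norm a)\<^sup>2)"
      using state_le_op_norm[OF _ subB oneB aaB] by (intro SUP_least) (auto simp: Q_peak_states_def)
    let ?S = "SUP \<omega>\<in>Q_peak_states A B. ereal (Re (\<omega> (star a ** a)))"
    have lower: "ereal ((max 0 (op_norm a - r))\<^sup>2) \<le> ?S" if r: "r > 0" for r
    proof -
      obtain \<xi> where \<xi>: "vector_state B \<xi> \<in> Q_peak_states A B" "op_norm a - r \<le> norm (a *v \<xi>)"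
        using approx[OF r] by blast
      have "(max 0 (op_norm a - r))\<^sup>2 \<le> (norm (a *v \<xi>))\<^sup>2"
        using \<xi>(2) by (intro power_mono) auto
      also have "\<dots> = Re (vector_state B \<xi> (star a ** a))"
        by (simp add: vector_state_gram[OF aaB] del: of_real_power)
      finally show ?thesis
        using \<xi>(1) by (intro SUP_upper2) auto
    qed
    have "((\<lambda>r. ereal ((max 0 (op_norm a - r))\<^sup>2)) \<longlongrightarrow> ereal ((max 0 (op_norm a - 0))\<^sup>2)) (at_right 0)"
      by (intro tendsto_intros)
    then have "ereal ((max 0 (op_norm a - 0))\<^sup>2) \<le> ?S"
      by (rule tendsto_upperbound) (auto simp: eventually_at_right_less lower intro: eventually_at_rightI[of 0 1])
    then show "ereal ((op_norm a)\<^sup>2) \<le> ?S"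
      using op_norm_nonneg[of a] by simp
  qed
qed

end
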